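(* Let $n\ge 1$, $d=2^n$, and let $\Phi$ be a quantum channel on an $n$-qubit system, with Pauli transfer matrix $\Gamma_{ij} = \frac1d\mathrm{Tr}[\mathcal{P}_i\Phi(\mathcal{P}_j)]$. Let $\rho_k = \frac1d\left[(1-\delta_{0k})I + \mathcal{P}_k\right]$ for $0\le k\le d^2-1$, and write $\langle\mathcal{P}_i\rangle_{\Phi(\rho_j)} = \mathrm{Tr}[\mathcal{P}_i\Phi(\rho_j)]$. Then for all $0\le i,j\le d^2-1$, $$\Gamma_{ij} = \langle\mathcal{P}_i\rangle_{\Phi(\rho_j)} - (1-\delta_{0j})\,\langle\mathcal{P}_i\rangle_{\Phi(\rho_0)} .$$
   Context: Let $\sigma_0 = I_2$, $\sigma_1 = X$, $\sigma_2 = Y$, $\sigma_3 = Z$ be the $2\times 2$ identity and Pauli matrices. The Pauli basis $\{\mathcal{P}_k : k=0,\dots,d^2-1\}$ consists of the operators $\sigma_{\alpha_1}\otimes\cdots\otimes\sigma_{\alpha_n}$ with $\alpha_1,\dots,\alpha_n\in\{0,1,2,3\}$, in lexicographic order; in particular $\mathcal{P}_0 = I$ is the $d\times d$ identity. A quantum channel is a linear completely positive trace-preserving map on $d\times d$ complex matrices. $\delta_{ij}$ is the Kronecker delta. Thus $\rho_0 = I/d$ and $\rho_k = (I+\mathcal{P}_k)/d$ for $k\neq 0$. *)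

theory Defs
  imports "Jordan_Normal_Form.Matrix" "Jordan_Normal_Form.Conjugate"
begin

definition mat_trace :: "complex mat \<Rightarrow> complex" where
  "mat_trace A = (\<Sum>i<dim_row A. A $$ (i, i))"

definition kron :: "complex mat \<Rightarrow> complex mat \<Rightarrow> complex mat" where
  "kron A B = mat (dim_row A * dim_row B) (dim_col A * dim_col B)
     (\<lambda>(i, j). A $$ (i div dim_row B, j div dim_col B) * B $$ (i mod dim_row B, j mod dim_col B))"

(* Only the arguments 0, 1, 2, 3 are used. *)
definition pauli_matrix :: "nat \<Rightarrow> complex mat" where
  "pauli_matrix \<alpha> =
     (if \<alpha> = 0 then 1\<^sub>m 2
      else if \<alpha> = 1 then mat_of_rows_list 2 [[0, 1], [1, 0]]
      else if \<alpha> = 2 then mat_of_rows_list 2 [[0, - \<i>], [\<i>, 0]]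
      else mat_of_rows_list 2 [[1, 0], [0, - 1]])"

fun pauli_string :: "nat list \<Rightarrow> complex mat" where
  "pauli_string [] = 1\<^sub>m 1"
| "pauli_string (\<alpha> # \<alpha>s) = kron (pauli_matrix \<alpha>) (pauli_string \<alpha>s)"

(* The k-th tuple of {0,1,2,3}^n in lexicographic order, k < 4^n: the base-4 digits of k,
   most significant digit first. *)
definition pauli_index :: "nat \<Rightarrow> nat \<Rightarrow> nat list" where
  "pauli_index n k = map (\<lambda>l. k div 4 ^ (n - 1 - l) mod 4) [0..<n]"

definition pauli :: "nat \<Rightarrow> nat \<Rightarrow> complex mat" where
  "pauli n k = pauli_string (pauli_index n k)"

(* The order on complex numbers is that of HOL-Library.Complex_Order:
   0 \<le> z means that z is real and nonnegative. *)
definition positive_semidefinite :: "nat \<Rightarrow> complex mat \<Rightarrow> bool" where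
  "positive_semidefinite d A \<longleftrightarrow>
     A \<in> carrier_mat d d \<and> (\<forall>v \<in> carrier_vec d. 0 \<le> (A *\<^sub>v v) \<bullet>c v)"

definition linear_mat_map :: "nat \<Rightarrow> (complex mat \<Rightarrow> complex mat) \<Rightarrow> bool" where
  "linear_mat_map d \<Phi> \<longleftrightarrow>
     (\<forall>A \<in> carrier_mat d d. \<Phi> A \<in> carrier_mat d d) \<and>
     (\<forall>A \<in> carrier_mat d d. \<forall>B \<in> carrier_mat d d. \<Phi> (A + B) = \<Phi> A + \<Phi> B) \<and>
     (\<forall>c. \<forall>A \<in> carrier_mat d d. \<Phi> (c \<cdot>\<^sub>m A) = c \<cdot>\<^sub>m \<Phi> A)"

definition mat_block :: "nat \<Rightarrow> complex mat \<Rightarrow> nat \<Rightarrow> nat \<Rightarrow> complex mat" where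
  "mat_block d A a b = mat d d (\<lambda>(i, j). A $$ (a * d + i, b * d + j))"

(* For linear \<Phi> this is the map id_m \<otimes> \<Phi> on (m d) x (m d) matrices:
   \<Phi> is applied to each of the m x m blocks of size d x d; see ampliation_kron below. *)
definition ampliation ::
  "nat \<Rightarrow> nat \<Rightarrow> (complex mat \<Rightarrow> complex mat) \<Rightarrow> complex mat \<Rightarrow> complex mat" where
  "ampliation m d \<Phi> A = mat (m * d) (m * d)
     (\<lambda>(i, j). \<Phi> (mat_block d A (i div d) (j div d)) $$ (i mod d, j mod d))"

definition completely_positive :: "nat \<Rightarrow> (complex mat \<Rightarrow> complex mat) \<Rightarrow> bool" where
  "completely_positive d \<Phi> \<longleftrightarrow>
     (\<forall>m A. positive_semidefinite (m * d) A \<longrightarrow>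
            positive_semidefinite (m * d) (ampliation m d \<Phi> A))"

definition trace_preserving :: "nat \<Rightarrow> (complex mat \<Rightarrow> complex mat) \<Rightarrow> bool" where
  "trace_preserving d \<Phi> \<longleftrightarrow> (\<forall>A \<in> carrier_mat d d. mat_trace (\<Phi> A) = mat_trace A)"

(* Only the values of \<Phi> on d x d matrices matter. *)
definition quantum_channel :: "nat \<Rightarrow> (complex mat \<Rightarrow> complex mat) \<Rightarrow> bool" where
  "quantum_channel d \<Phi> \<longleftrightarrow>
     linear_mat_map d \<Phi> \<and> completely_positive d \<Phi> \<and> trace_preserving d \<Phi>"

definition pauli_expectation :: "nat \<Rightarrow> nat \<Rightarrow> complex mat \<Rightarrow> complex" where
  "pauli_expectation n i \<rho> = mat_trace (pauli n i * \<rho>)"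

definition pauli_transfer ::
  "nat \<Rightarrow> (complex mat \<Rightarrow> complex mat) \<Rightarrow> nat \<Rightarrow> nat \<Rightarrow> complex" where
  "pauli_transfer n \<Phi> i j = 1 / 2 ^ n * mat_trace (pauli n i * \<Phi> (pauli n j))"

definition kronecker_delta :: "nat \<Rightarrow> nat \<Rightarrow> complex" where
  "kronecker_delta i j = (if i = j then 1 else 0)"

definition pauli_state :: "nat \<Rightarrow> nat \<Rightarrow> complex mat" where
  "pauli_state n k =
     (1 / 2 ^ n) \<cdot>\<^sub>m ((1 - kronecker_delta 0 k) \<cdot>\<^sub>m 1\<^sub>m (2 ^ n) + pauli n k)"

lemma ampliation_kron:
  assumes \<Phi>: "linear_mat_map d \<Phi>" and A: "A \<in> carrier_mat m m" and B: "B \<in> carrier_mat d d"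
  shows "ampliation m d \<Phi> (kron A B) = kron A (\<Phi> B)"
proof -
  have \<Phi>B: "\<Phi> B \<in> carrier_mat d d" using \<Phi> B by (auto simp: linear_mat_map_def)
  have block: "mat_block d (kron A B) a b = A $$ (a, b) \<cdot>\<^sub>m B" if "a < m" "b < m" for a b
  proof -
    have "x * d + i < m * d" if "x < m" "i < d" for x i
    proof -
      have "x * d + i < Suc x * d" using that by simp
      also have "\<dots> \<le> m * d" using that by (intro mult_le_mono1) simp
      finally show ?thesis .
    qed
    then show ?thesis using that A B
      by (intro eq_matI) (auto simp: mat_block_def kron_def)
  qed
  show ?thesis
  proof (rule eq_matI)
    fix i j assume "i < dim_row (kron A (\<Phi> B))" "j < dim_col (kron A (\<Phi> B))"
    then have ij: "i < m * d" "j < m * d" using A \<Phi>B by (auto simp: kron_def)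
    then have d: "0 < d" by (cases d) auto
    have q: "i div d < m" "j div d < m" using ij by (auto intro: less_mult_imp_div_less)
    have "\<Phi> (A $$ (i div d, j div d) \<cdot>\<^sub>m B) = A $$ (i div d, j div d) \<cdot>\<^sub>m \<Phi> B"
      using \<Phi> B by (auto simp: linear_mat_map_def)
    then have "ampliation m d \<Phi> (kron A B) $$ (i, j) = (A $$ (i div d, j div d) \<cdot>\<^sub>m \<Phi> B) $$ (i mod d, j mod d)"
      using ij by (simp add: ampliation_def block[OF q])
    also have "\<dots> = kron A (\<Phi> B) $$ (i, j)"
      using ij d A \<Phi>B by (simp add: kron_def)
    finally show "ampliation m d \<Phi> (kron A B) $$ (i, j) = kron A (\<Phi> B) $$ (i, j)" .
  qed (use A \<Phi>B in \<open>auto simp: ampliation_def kron_def\<close>)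
qed

lemma pauli_index_Suc:
  "pauli_index (Suc n) k = k div 4 ^ n mod 4 # pauli_index n (k mod 4 ^ n)"
proof -
  have digit: "k div 4 ^ e mod 4 = (k mod 4 ^ n) div 4 ^ e mod 4" if "e < n" for e
  proof -
    define f where "f = n - Suc e"
    have "n = e + Suc f" using that by (simp add: f_def)
    then have n: "(4 :: nat) ^ n = 4 ^ e * 4 ^ Suc f" by (simp only: power_add)
    have "(k mod 4 ^ n) div 4 ^ e = (k div 4 ^ e) mod 4 ^ Suc f"
      unfolding n mod_mult2_eq[of k "4 ^ e" "4 ^ Suc f"] by (simp del: power_Suc)
    moreover have "(k div 4 ^ e) mod 4 ^ Suc f mod 4 = k div 4 ^ e mod 4"
      by (rule mod_mod_cancel) simp
    ultimately show ?thesis by (simp only:)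
  qed
  show ?thesis
  proof (rule nth_equalityI)
    fix l assume l: "l < length (pauli_index (Suc n) k)"
    show "pauli_index (Suc n) k ! l = (k div 4 ^ n mod 4 # pauli_index n (k mod 4 ^ n)) ! l"
    proof (cases l)
      case 0
      then show ?thesis by (simp add: pauli_index_def del: upt_Suc)
    next
      case (Suc l')
      with l have "l' < n" by (simp add: pauli_index_def)
      then show ?thesis using digit[of "n - 1 - l'"] Suc
        by (simp add: pauli_index_def del: upt_Suc)
    qed
  qed (simp add: pauli_index_def)
qed

lemma pauli_0: "pauli n 0 = 1\<^sub>m (2 ^ n)"
proof (induction n)
  case 0
  show ?case by (simp add: pauli_def pauli_index_def)
next
  case (Suc n)
  have "kron (1\<^sub>m 2) (1\<^sub>m (2 ^ n)) = 1\<^sub>m (2 ^ Suc n)"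
  proof (rule eq_matI)
    fix i j :: nat
    assume "i < dim_row (1\<^sub>m (2 ^ Suc n) :: complex mat)" "j < dim_col (1\<^sub>m (2 ^ Suc n) :: complex mat)"
    then have ij: "i < 2 * 2 ^ n" "j < 2 * 2 ^ n" by auto
    then have "i div 2 ^ n < 2" "j div 2 ^ n < 2" by (auto intro: less_mult_imp_div_less)
    moreover have "i = j \<longleftrightarrow> i div 2 ^ n = j div 2 ^ n \<and> i mod 2 ^ n = j mod 2 ^ n"
      by (metis div_mult_mod_eq)
    ultimately show "kron (1\<^sub>m 2) (1\<^sub>m (2 ^ n)) $$ (i, j) = 1\<^sub>m (2 ^ Suc n) $$ (i, j)"
      using ij by (auto simp: kron_def)
  qed (auto simp: kron_def)
  with Suc show ?case by (simp add: pauli_def pauli_index_Suc pauli_matrix_def)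
qed

lemma pauli_index_lexicographic:
  "map (pauli_index n) [0..<4 ^ n] = product_lists (replicate n [0, 1, 2, 3])"
proof (induction n)
  case 0
  show ?case by (simp add: pauli_index_def)
next
  case (Suc n)
  let ?N = "4 ^ n :: nat"
  have block: "map (pauli_index (Suc n)) [a * ?N..<a * ?N + ?N]
      = map ((#) a) (product_lists (replicate n [0, 1, 2, 3]))" if "a < 4" for a
  proof -
    have "[a * ?N..<a * ?N + ?N] = map (\<lambda>i. i + a * ?N) [0..<?N]"
      by (simp only: map_add_upt add.commute add_0)
    moreover have "pauli_index (Suc n) (i + a * ?N) = a # pauli_index n i" if "i < ?N" for i
      using that \<open>a < 4\<close> unfolding pauli_index_Suc by simp
    ultimately show ?thesis
      unfolding Suc.IH[symmetric] by simp
  qed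
  have split: "[0..<c * ?N] = concat (map (\<lambda>a. [a * ?N..<a * ?N + ?N]) [0..<c])" for c
  proof (induction c)
    case (Suc c)
    have "[0..<Suc c * ?N] = [0..<c * ?N] @ [c * ?N..<c * ?N + ?N]"
      using upt_add_eq_append[of 0 "c * ?N" ?N] by (simp only: mult_Suc add.commute)
    with Suc show ?case by simp
  qed simp
  have "map (pauli_index (Suc n)) [0..<4 ^ Suc n]
     = concat (map (\<lambda>a. map (pauli_index (Suc n)) [a * ?N..<a * ?N + ?N]) [0..<4])"
    by (simp only: power_Suc split map_concat map_map o_def)
  also have "map (\<lambda>a. map (pauli_index (Suc n)) [a * ?N..<a * ?N + ?N]) [0..<4]
     = map (\<lambda>a. map ((#) a) (product_lists (replicate n [0, 1, 2, 3]))) [0..<4]"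
    by (rule map_cong[OF refl], rule block) simp
  also have "[0..<4::nat] = [0, 1, 2, 3]"
    by (simp add: upt_rec)
  finally show ?case by simp
qed

end

theory Submission
  imports Defs
begin

text \<open>Both \<Phi> and the functional A -> Tr[P_i A] are linear, so the expectation in
  \<Phi>(rho_k) is 1/d times (1 - delta_0k) Tr[P_i \<Phi>(I)] + Tr[P_i \<Phi>(P_k)]; this is
  \<open>pauli_expectation_map_pauli_state\<close>. The second term yields the transfer matrix
  entry. The first is an offset caused by the identity added to make rho_k a state. As P_0 = I
  (\<open>pauli_0\<close>), rho_0 = I/d measures exactly this offset, and subtracting it for j
  \<noteq> 0 leaves the entry.\<close>

lemma mat_trace_add:
  assumes "A \<in> carrier_mat d d" and "B \<in> carrier_mat d d"
  shows "mat_trace (A + B) = mat_trace A + mat_trace B"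
  using assms by (simp add: mat_trace_def sum.distrib)

lemma mat_trace_smult:
  assumes "A \<in> carrier_mat d d"
  shows "mat_trace (c \<cdot>\<^sub>m A) = c * mat_trace A"
  using assms by (simp add: mat_trace_def sum_distrib_left)

lemma pauli_matrix_carrier: "pauli_matrix \<alpha> \<in> carrier_mat 2 2"
  by (simp add: pauli_matrix_def mat_of_rows_list_def numeral_2_eq_2)

lemma pauli_string_carrier:
  "pauli_string \<alpha>s \<in> carrier_mat (2 ^ length \<alpha>s) (2 ^ length \<alpha>s)"
  using pauli_matrix_carrier by (induction \<alpha>s) (fastforce simp: kron_def)+

text \<open>Matrix sizes are not part of the type, so distributivity of the product and linearity of
  \<Phi> can be applied to Pauli operators only through this fact.\<close>

lemma pauli_carrier: "pauli n k \<in> carrier_mat (2 ^ n) (2 ^ n)"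
  using pauli_string_carrier[of "pauli_index n k"] by (simp add: pauli_def pauli_index_def)

lemma pauli_expectation_add:
  assumes "A \<in> carrier_mat (2 ^ n) (2 ^ n)" and "B \<in> carrier_mat (2 ^ n) (2 ^ n)"
  shows "pauli_expectation n i (A + B) = pauli_expectation n i A + pauli_expectation n i B"
  unfolding pauli_expectation_def mult_add_distrib_mat[OF pauli_carrier assms]
  by (rule mat_trace_add[OF assms[THEN mult_carrier_mat[OF pauli_carrier]]])

lemma pauli_expectation_smult:
  assumes "A \<in> carrier_mat (2 ^ n) (2 ^ n)"
  shows "pauli_expectation n i (c \<cdot>\<^sub>m A) = c * pauli_expectation n i A"
  unfolding pauli_expectation_def mult_smult_distrib[OF pauli_carrier assms]
  by (rule mat_trace_smult[OF mult_carrier_mat[OF pauli_carrier assms]])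

lemma pauli_expectation_map_pauli_state:
  assumes "linear_mat_map (2 ^ n) \<Phi>"
  shows "pauli_expectation n i (\<Phi> (pauli_state n k)) =
    1 / 2 ^ n * ((1 - kronecker_delta 0 k) * pauli_expectation n i (\<Phi> (1\<^sub>m (2 ^ n)))
      + pauli_expectation n i (\<Phi> (pauli n k)))"
proof -
  note lin = assms[unfolded linear_mat_map_def]
  \<comment> \<open>Additivity and homogeneity of \<Phi> hold on matrices of size
    \<open>2 ^ n\<close> only, hence the appeal to \<open>pauli_carrier\<close>.\<close>
  have "\<Phi> (pauli_state n k) = (1 / 2 ^ n) \<cdot>\<^sub>m
      ((1 - kronecker_delta 0 k) \<cdot>\<^sub>m \<Phi> (1\<^sub>m (2 ^ n)) + \<Phi> (pauli n k))"
    using lin pauli_carrier[of n k] by (simp add: pauli_state_def)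
  moreover have "\<Phi> (1\<^sub>m (2 ^ n)) \<in> carrier_mat (2 ^ n) (2 ^ n)"
    and "\<Phi> (pauli n k) \<in> carrier_mat (2 ^ n) (2 ^ n)"
    using lin pauli_carrier[of n k] by auto
  ultimately show ?thesis
    by (simp add: pauli_expectation_add pauli_expectation_smult)
qed

theorem mainTheorem2:
  fixes n d i j :: nat and \<Phi> :: "complex mat \<Rightarrow> complex mat"
  assumes "n \<ge> 1" and "d = 2 ^ n"
    and "quantum_channel d \<Phi>"
    and "i \<le> d ^ 2 - 1" and "j \<le> d ^ 2 - 1"
  shows "pauli_transfer n \<Phi> i j =
    pauli_expectation n i (\<Phi> (pauli_state n j))
      - (1 - kronecker_delta 0 j) * pauli_expectation n i (\<Phi> (pauli_state n 0))"
proof -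
  have lin: "linear_mat_map (2 ^ n) \<Phi>"
    using assms by (simp add: quantum_channel_def)
  have "pauli_transfer n \<Phi> i j = 1 / 2 ^ n * pauli_expectation n i (\<Phi> (pauli n j))"
    by (simp add: pauli_transfer_def pauli_expectation_def)
  \<comment> \<open>For j = 0 both delta factors vanish and the offset never appears. For j \<noteq>
    0 both factors are 1 and the offsets Tr[P_i \<Phi>(I)]/d cancel.\<close>
  then show ?thesis
    by (simp add: pauli_expectation_map_pauli_state[OF lin] pauli_0 kronecker_delta_def add_divide_distrib)
qed

end
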